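(* Let $V$ be a vector space over a field, let $U$ be a subspace of $V$ with $U\neq V$, and let $L_{GL(U)}(V)=\{\alpha\in L(V):\alpha|_U\in GL(U)\}$. The minimal ideal of $L_{GL(U)}(V)$ is the set \[ \{\alpha\in L_{GL(U)}(V):\dim(V\alpha/U)=0\}. \]
   Context: $L(V)$ is the semigroup of all linear maps $V\to V$ under composition; maps are written on the right and composed from left to right, and $V\alpha$ is the range of $\alpha$. $GL(U)$ is the group of all bijective linear maps $U\to U$; $\alpha|_U\in GL(U)$ means that $\alpha$ restricts to a bijection of $U$ onto $U$ (so $U\subseteq V\alpha$). $V$ may be infinite-dimensional. An ideal of a semigroup $S$ is a nonempty subset $I$ with $SI\subseteq I$ and $IS\subseteq I$; the minimal ideal is the smallest ideal under inclusion. (In the paper this set is denoted $Q(1)=J(0)$, where $Q(k)=\{\alpha\in L_{GL(U)}(V):\dim(V\alpha/U)<k\}$ and $J(k)=\{\alpha\in L_{GL(U)}(V):\dim(V\alpha/U)=k\}$.) *)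

theory Defs
  imports Complex_Main
begin

unbundle cardinal_syntax

text \<open>
  Two-sided ideals of a semigroup with carrier \<open>S\<close> and multiplication \<open>mul\<close>; the minimal
  ideal is the least one with respect to inclusion, not merely a minimal element.
\<close>

definition semigroup_ideal :: "('m \<Rightarrow> 'm \<Rightarrow> 'm) \<Rightarrow> 'm set \<Rightarrow> 'm set \<Rightarrow> bool" where
  "semigroup_ideal mul S I \<longleftrightarrow>
     I \<noteq> {} \<and> I \<subseteq> S \<and> (\<forall>s\<in>S. \<forall>i\<in>I. mul s i \<in> I) \<and> (\<forall>i\<in>I. \<forall>s\<in>S. mul i s \<in> I)"

definition is_minimal_ideal :: "('m \<Rightarrow> 'm \<Rightarrow> 'm) \<Rightarrow> 'm set \<Rightarrow> 'm set \<Rightarrow> bool" where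
  "is_minimal_ideal mul S I \<longleftrightarrow>
     semigroup_ideal mul S I \<and> (\<forall>J. semigroup_ideal mul S J \<longrightarrow> I \<subseteq> J)"

text \<open>Maps act on the right, so the product \<open>\<alpha>\<beta>\<close> is first \<open>\<alpha>\<close>, then \<open>\<beta>\<close>.\<close>

definition comp_right :: "('v \<Rightarrow> 'v) \<Rightarrow> ('v \<Rightarrow> 'v) \<Rightarrow> 'v \<Rightarrow> 'v" where
  "comp_right \<alpha> \<beta> = \<beta> \<circ> \<alpha>"

definition L_GL ::
  "('a::field \<Rightarrow> 'b::ab_group_add \<Rightarrow> 'b) \<Rightarrow> 'b set \<Rightarrow> ('b \<Rightarrow> 'b) set" where
  "L_GL scale U = {\<alpha>. Vector_Spaces.linear scale scale \<alpha> \<and> bij_betw \<alpha> U U}"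

lemma (in vector_space) comp_right_in_L_GL:
  "\<alpha> \<in> L_GL scale U \<Longrightarrow> \<beta> \<in> L_GL scale U \<Longrightarrow> comp_right \<alpha> \<beta> \<in> L_GL scale U"
  unfolding L_GL_def comp_right_def
  by (auto intro: Vector_Spaces.linear_compose bij_betw_trans)

text \<open>
  The quotient \<open>W/U\<close> of subspaces \<open>U \<subseteq> W\<close> is the set of cosets, with zero element \<open>U\<close>.
  In the scalar multiple the summand from \<open>U\<close> is only needed for the scalar \<open>0\<close>.
\<close>

definition coset :: "'b::ab_group_add set \<Rightarrow> 'b \<Rightarrow> 'b set" where
  "coset U x = {x + u | u. u \<in> U}"

definition quotient_space :: "'b::ab_group_add set \<Rightarrow> 'b set \<Rightarrow> 'b set set" where
  "quotient_space W U = coset U ` W"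

definition coset_add :: "'b::ab_group_add set \<Rightarrow> 'b set \<Rightarrow> 'b set" where
  "coset_add A B = {a + b | a b. a \<in> A \<and> b \<in> B}"

definition coset_scale ::
  "('a::field \<Rightarrow> 'b::ab_group_add \<Rightarrow> 'b) \<Rightarrow> 'b set \<Rightarrow> 'a \<Rightarrow> 'b set \<Rightarrow> 'b set" where
  "coset_scale scale U c A = {scale c a + u | a u. a \<in> A \<and> u \<in> U}"

lemma (in vector_space) coset_add_coset:
  assumes "subspace U"
  shows "coset_add (coset U x) (coset U y) = coset U (x + y)"
proof (intro set_eqI iffI)
  fix z assume "z \<in> coset_add (coset U x) (coset U y)"
  then obtain u v where "u \<in> U" "v \<in> U" "z = (x + u) + (y + v)"
    unfolding coset_add_def coset_def by blast
  then have "u + v \<in> U" "z = (x + y) + (u + v)"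
    using assms by (auto simp: subspace_add algebra_simps)
  then show "z \<in> coset U (x + y)" unfolding coset_def by blast
next
  fix z assume "z \<in> coset U (x + y)"
  then obtain u where "u \<in> U" "z = (x + 0) + (y + u)"
    unfolding coset_def by (auto simp: algebra_simps)
  then show "z \<in> coset_add (coset U x) (coset U y)"
    using subspace_0[OF assms] unfolding coset_add_def coset_def by blast
qed

lemma (in vector_space) coset_scale_coset:
  assumes "subspace U"
  shows "coset_scale scale U c (coset U x) = coset U (scale c x)"
proof (intro set_eqI iffI)
  fix z assume "z \<in> coset_scale scale U c (coset U x)"
  then obtain u v where "u \<in> U" "v \<in> U" "z = scale c (x + u) + v"
    unfolding coset_scale_def coset_def by blast
  then have "scale c u + v \<in> U" "z = scale c x + (scale c u + v)"
    using assms by (auto simp: subspace_add subspace_scale scale_right_distrib algebra_simps)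
  then show "z \<in> coset U (scale c x)" unfolding coset_def by blast
next
  fix z assume "z \<in> coset U (scale c x)"
  then obtain u where "u \<in> U" "z = scale c (x + 0) + u"
    unfolding coset_def by auto
  then show "z \<in> coset_scale scale U c (coset U x)"
    using subspace_0[OF assms] unfolding coset_scale_def coset_def by blast
qed

definition quotient_subspace ::
  "('a::field \<Rightarrow> 'b::ab_group_add \<Rightarrow> 'b) \<Rightarrow> 'b set \<Rightarrow> 'b set \<Rightarrow> 'b set set \<Rightarrow> bool" where
  "quotient_subspace scale W U S \<longleftrightarrow>
     S \<subseteq> quotient_space W U \<and> U \<in> S \<and>
     (\<forall>A\<in>S. \<forall>B\<in>S. coset_add A B \<in> S) \<and> (\<forall>c. \<forall>A\<in>S. coset_scale scale U c A \<in> S)"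

definition quotient_span ::
  "('a::field \<Rightarrow> 'b::ab_group_add \<Rightarrow> 'b) \<Rightarrow> 'b set \<Rightarrow> 'b set \<Rightarrow> 'b set set \<Rightarrow> 'b set set" where
  "quotient_span scale W U B = quotient_subspace scale W U hull B"

definition quotient_basis ::
  "('a::field \<Rightarrow> 'b::ab_group_add \<Rightarrow> 'b) \<Rightarrow> 'b set \<Rightarrow> 'b set \<Rightarrow> 'b set set \<Rightarrow> bool" where
  "quotient_basis scale W U B \<longleftrightarrow>
     B \<subseteq> quotient_space W U \<and>
     (\<forall>b\<in>B. b \<notin> quotient_span scale W U (B - {b})) \<and>
     quotient_span scale W U B = quotient_space W U"

text \<open>
  The dimension of \<open>W/U\<close> is a cardinal. The natural number valued \<open>dim\<close> is unsuitable: it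
  gives \<open>0\<close> for every infinite-dimensional space. As there, a basis is picked by \<open>SOME\<close>;
  any two bases have the same cardinality.
\<close>

definition quotient_dim ::
  "('a::field \<Rightarrow> 'b::ab_group_add \<Rightarrow> 'b) \<Rightarrow> 'b set \<Rightarrow> 'b set \<Rightarrow> 'b set rel" where
  "quotient_dim scale W U = |SOME B. quotient_basis scale W U B|"

end

theory Submission
  imports Defs
begin

text \<open>
  A map \<open>\<alpha>\<close> in \<open>L_GL scale U\<close> maps \<open>U\<close> onto itself, so \<open>dim (V\<alpha>/U) = 0\<close> means \<open>V\<alpha> = U\<close>, and maps
  with range \<open>U\<close> clearly form an ideal. It is least: any \<open>j\<close> in any ideal restricts to a bijection of
  \<open>U\<close>, whose inverse extends to a linear map \<open>g\<close> with range \<open>U\<close>; if \<open>V\<alpha> = U\<close>, then \<open>\<alpha> = (\<alpha>g)j\<close>.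
\<close>

context vector_space
begin

lemma coset_self: "subspace U \<Longrightarrow> x \<in> coset U x"
  unfolding coset_def using subspace_0 by force

lemma coset_zero: "coset U 0 = U"
  by (simp add: coset_def)

lemma coset_eq_iff:
  assumes "subspace U"
  shows "coset U x = coset U y \<longleftrightarrow> x - y \<in> U"
proof
  assume "coset U x = coset U y"
  then show "x - y \<in> U"
    using coset_self[OF assms, of x] by (auto simp: coset_def)
next
  assume d: "x - y \<in> U"
  \<comment> \<open>As \<open>x = y + (x - y)\<close>, it is enough that \<open>x - y\<close>
    represents the zero coset.\<close>
  have "coset_add (coset U y) (coset U (x - y)) = coset U x"
    using coset_add_coset[OF assms] by simp
  moreover have "coset U (x - y) = coset U 0"
  proof (intro set_eqI iffI)
    fix z assume "z \<in> coset U (x - y)"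
    then show "z \<in> coset U 0"
      using d assms by (auto simp: coset_def subspace_add)
  next
    fix z assume "z \<in> coset U 0"
    then have "z - (x - y) \<in> U" "z = (x - y) + (z - (x - y))"
      using d assms by (auto simp: coset_zero subspace_diff)
    then show "z \<in> coset U (x - y)" unfolding coset_def by blast
  qed
  ultimately show "coset U x = coset U y"
    using coset_add_coset[OF assms, of y 0] by simp
qed

lemma quotient_subspace_image:
  assumes "subspace U" "subspace T" "T \<subseteq> W"
  shows "quotient_subspace scale W U (coset U ` T)"
  unfolding quotient_subspace_def
proof (intro conjI ballI allI)
  show "coset U ` T \<subseteq> quotient_space W U"
    unfolding quotient_space_def using assms(3) by (rule image_mono)
  show "U \<in> coset U ` T"
    using imageI[OF subspace_0[OF assms(2)], of "coset U"] by (simp add: coset_zero)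
  fix A assume "A \<in> coset U ` T"
  then obtain x where x: "x \<in> T" "A = coset U x" by blast
  show "coset_scale scale U c A \<in> coset U ` T" for c
    unfolding x(2) coset_scale_coset[OF assms(1)]
    using x(1) by (intro imageI subspace_scale[OF assms(2)])
  fix B assume "B \<in> coset U ` T"
  then obtain y where y: "y \<in> T" "B = coset U y" by blast
  show "coset_add A B \<in> coset U ` T"
    unfolding x(2) y(2) coset_add_coset[OF assms(1)]
    using x(1) y(1) by (intro imageI subspace_add[OF assms(2)])
qed

text \<open>The projection \<open>coset U\<close> respects addition and scaling, so preimages of
  quotient subspaces are subspaces. This turns minimality of \<open>span\<close> into a statement
  about the quotient.\<close>

lemma subspace_vimage_coset:
  assumes "subspace U" "quotient_subspace scale W U S"
  shows "subspace {x. coset U x \<in> S}"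
proof (rule subspaceI)
  show "0 \<in> {x. coset U x \<in> S}"
    using assms(2) by (simp add: quotient_subspace_def coset_zero)
next
  fix x y assume "x \<in> {x. coset U x \<in> S}" "y \<in> {x. coset U x \<in> S}"
  then show "x + y \<in> {x. coset U x \<in> S}"
    using assms(2) coset_add_coset[OF assms(1), of x y]
    unfolding quotient_subspace_def by (metis mem_Collect_eq)
next
  fix c x assume "x \<in> {x. coset U x \<in> S}"
  then show "scale c x \<in> {x. coset U x \<in> S}"
    using assms(2) coset_scale_coset[OF assms(1), of c x]
    unfolding quotient_subspace_def by (metis mem_Collect_eq)
qed

text \<open>Images and preimages under \<open>coset U\<close> carry subspaces to subspaces, so each
  of the two spans satisfies the minimality property of the other. Questions about bases of the
  quotient thereby become questions about \<open>span\<close>.\<close>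

lemma quotient_span_image:
  assumes "subspace U" "subspace W" "C \<subseteq> W"
  shows "quotient_span scale W U (coset U ` C) = coset U ` span C"
proof
  have "span C \<subseteq> W" using assms span_minimal by blast
  then show "quotient_span scale W U (coset U ` C) \<subseteq> coset U ` span C"
    unfolding quotient_span_def using assms
    by (intro hull_minimal quotient_subspace_image image_mono span_superset) auto
next
  have "coset U ` span C \<subseteq> S"
    if "quotient_subspace scale W U S" "coset U ` C \<subseteq> S" for S
    using span_minimal[of C "{x. coset U x \<in> S}"] subspace_vimage_coset[OF assms(1) that(1)] that(2)
    by blast
  then show "coset U ` span C \<subseteq> quotient_span scale W U (coset U ` C)"
    unfolding quotient_span_def hull_def by blast
qed

text \<open>Extend a basis \<open>B0\<close> of \<open>U\<close> to a basis \<open>B1\<close> of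
  \<open>W\<close>; the cosets of the added vectors form a basis of the quotient. Existence ensures
  that the \<open>SOME\<close> in \<open>quotient_dim\<close> picks an actual basis.\<close>

lemma quotient_basis_exists:
  assumes U: "subspace U" and W: "subspace W" and "U \<subseteq> W"
  shows "\<exists>B. quotient_basis scale W U B"
proof -
  obtain B0 where B0: "B0 \<subseteq> U" "independent B0" "U \<subseteq> span B0"
    using maximal_independent_subset by blast
  obtain B1 where B1: "B0 \<subseteq> B1" "B1 \<subseteq> W" "independent B1" "W \<subseteq> span B1"
    using maximal_independent_subset_extend[of B0 W] B0 \<open>U \<subseteq> W\<close> by blast
  define C where "C = B1 - B0"
  have CW: "C \<subseteq> W" using B1 C_def by blast
  have "quotient_space W U \<subseteq> coset U ` span C"
  proof
    fix A assume "A \<in> quotient_space W U"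
    then obtain w where w: "w \<in> W" "A = coset U w" by (auto simp: quotient_space_def)
    \<comment> \<open>Split \<open>w\<close> along \<open>C\<close> and \<open>B0\<close>; the
      \<open>B0\<close> part lies in \<open>U\<close> and vanishes in the quotient.\<close>
    have "w \<in> span (C \<union> B0)" using w B1 C_def by (auto simp: Un_absorb2)
    then obtain c u where cu: "w = c + u" "c \<in> span C" "u \<in> span B0"
      by (auto simp: span_Un)
    have "u \<in> U" using cu(3) span_minimal[OF B0(1) U] by blast
    then have "A = coset U c" using w cu coset_eq_iff[OF U] by simp
    then show "A \<in> coset U ` span C" using cu by blast
  qed
  moreover have "coset U ` span C \<subseteq> quotient_space W U"
    using span_minimal[OF CW W] by (auto simp: quotient_space_def)
  ultimately have spans: "quotient_span scale W U (coset U ` C) = quotient_space W U"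
    using quotient_span_image[OF U W CW] by simp
  have "coset U x \<notin> quotient_span scale W U (coset U ` C - {coset U x})" if x: "x \<in> C" for x
  proof
    \<comment> \<open>Injectivity of \<open>coset U\<close> on \<open>C\<close> has not been shown,
      so removing one coset might remove several vectors; \<open>D\<close> collects the vectors that
      remain.\<close>
    define D where "D = {c \<in> C. coset U c \<noteq> coset U x}"
    have D: "coset U ` C - {coset U x} = coset U ` D" "D \<subseteq> W" "D \<subseteq> B1 - {x}"
      using CW by (auto simp: D_def C_def)
    assume "coset U x \<in> quotient_span scale W U (coset U ` C - {coset U x})"
    then obtain y where y: "y \<in> span D" "coset U x = coset U y"
      using quotient_span_image[OF U W D(2)] D(1) by auto
    have "y \<in> span (B1 - {x})" using y(1) span_mono[OF D(3)] by blast
    \<comment> \<open>Equal cosets differ by an element of \<open>U\<close>, which \<open>B0\<close>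
      spans, and \<open>x\<close> is not in \<open>B0\<close>.\<close>
    moreover have "x - y \<in> span (B1 - {x})"
    proof -
      have "B0 \<subseteq> B1 - {x}" using B1(1) x by (auto simp: C_def)
      then show ?thesis
        using y(2) coset_eq_iff[OF U] B0(3) span_mono by blast
    qed
    ultimately have "x \<in> span (B1 - {x})"
      using span_add[of y "B1 - {x}" "x - y"] by simp
    then show False using B1(3) x by (auto simp: dependent_def C_def)
  qed
  then show ?thesis
    using spans CW unfolding quotient_basis_def quotient_space_def
    by (intro exI[of _ "coset U ` C"]) auto
qed

lemma quotient_basis_empty_iff:
  assumes "subspace U" "subspace W" "U \<subseteq> W"
  shows "quotient_basis scale W U {} \<longleftrightarrow> W = U"
proof -
  have "quotient_span scale W U {} = {U}"
    using quotient_span_image[OF assms(1,2), of "{}"] by (simp add: coset_zero)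
  moreover have "quotient_space W U = {U} \<longleftrightarrow> W = U"
  proof
    assume "quotient_space W U = {U}"
    then show "W = U"
      using coset_self[OF assms(1)] assms(3) by (auto simp: quotient_space_def)
  next
    assume [simp]: "W = U"
    have "coset U x = U" if "x \<in> U" for x
      using coset_eq_iff[OF assms(1), of x 0] that by (simp add: coset_zero)
    then show "quotient_space W U = {U}"
      using subspace_0[OF assms(1)] by (force simp: quotient_space_def)
  qed
  ultimately show ?thesis by (auto simp: quotient_basis_def)
qed

text \<open>The only available element is the zero coset \<open>U\<close>, which lies in every span,
  so independence excludes it.\<close>

lemma quotient_basis_self_empty:
  assumes "subspace U" "quotient_basis scale U U B"
  shows "B = {}"
proof -
  have "quotient_space U U = {U}"
    using quotient_basis_empty_iff[OF assms(1,1)] quotient_span_image[OF assms(1,1), of "{}"]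
    by (simp add: quotient_basis_def coset_zero)
  moreover have "U \<in> quotient_span scale U U X" for X
    unfolding quotient_span_def hull_def by (auto simp: quotient_subspace_def)
  moreover have "B \<subseteq> quotient_space U U" "\<forall>b\<in>B. b \<notin> quotient_span scale U U (B - {b})"
    using assms(2) by (simp_all add: quotient_basis_def)
  ultimately show ?thesis by (metis empty_iff subset_singletonD singletonI)
qed

text \<open>The basis behind \<open>SOME\<close> is arbitrary, so in the case \<open>W = U\<close>
  every basis has to be empty; conversely, an empty basis spans only the zero coset.\<close>

lemma quotient_dim_eq_zero_iff:
  assumes "subspace U" "subspace W" "U \<subseteq> W"
  shows "quotient_dim scale W U =o (czero :: 'b set rel) \<longleftrightarrow> W = U"
proof -
  define B where "B = (SOME B. quotient_basis scale W U B)"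
  have B: "quotient_basis scale W U B"
    unfolding B_def using quotient_basis_exists[OF assms] by (rule someI_ex)
  have "quotient_dim scale W U =o (czero :: 'b set rel) \<longleftrightarrow> B = {}"
    unfolding quotient_dim_def B_def[symmetric] by (rule card_of_ordIso_czero_iff_empty)
  also have "\<dots> \<longleftrightarrow> W = U"
    using B quotient_basis_empty_iff[OF assms] quotient_basis_self_empty[OF assms(1)] by auto
  finally show ?thesis .
qed

lemma L_GL_quotient_dim_zero:
  assumes "subspace U"
  shows "{\<alpha> \<in> L_GL scale U. quotient_dim scale (range \<alpha>) U =o (czero :: 'b set rel)}
       = {\<alpha> \<in> L_GL scale U. range \<alpha> = U}"
proof -
  have "quotient_dim scale (range \<alpha>) U =o (czero :: 'b set rel) \<longleftrightarrow> range \<alpha> = U"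
    if "\<alpha> \<in> L_GL scale U" for \<alpha>
  proof (rule quotient_dim_eq_zero_iff[OF assms])
    interpret \<alpha>: Vector_Spaces.linear scale scale \<alpha>
      using that by (simp add: L_GL_def)
    show "subspace (range \<alpha>)"
      by (rule \<alpha>.subspace_image[OF subspace_UNIV])
    show "U \<subseteq> range \<alpha>"
      using that by (auto simp: L_GL_def bij_betw_def)
  qed
  then show ?thesis by blast
qed

text \<open>A linear map injective on \<open>U\<close> has a linear left inverse there, defined on
  the whole space with values in \<open>U\<close>.\<close>

lemma L_GL_inverse_extension:
  assumes "subspace U" "\<alpha> \<in> L_GL scale U"
  obtains g where "g \<in> L_GL scale U" "range g = U" "\<forall>u\<in>U. \<alpha> (g u) = u"
proof -
  interpret vector_space_pair scale scale ..
  have \<alpha>: "Vector_Spaces.linear scale scale \<alpha>" "inj_on \<alpha> U" "\<alpha> ` U = U"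
    using assms(2) by (auto simp: L_GL_def bij_betw_def)
  obtain g where g: "range g \<subseteq> U" "Vector_Spaces.linear scale scale g" "\<forall>u\<in>U. g (\<alpha> u) = u"
    using linear_exists_left_inverse_on[OF \<alpha>(1) assms(1) \<alpha>(2)] by blast
  \<comment> \<open>Since \<alpha> maps \<open>U\<close> onto \<open>U\<close>, the left inverse is
    also a right inverse on \<open>U\<close>.\<close>
  have inv: "\<alpha> (g u) = u" if "u \<in> U" for u
    using that \<alpha>(3) g(3) by (metis imageE)
  have "bij_betw g U U"
    using g \<alpha> inv by (intro bij_betw_byWitness[where f' = \<alpha>]) auto
  moreover from this have "U \<subseteq> range g"
    using image_mono[of U UNIV g] by (simp add: bij_betw_def)
  ultimately have "g \<in> L_GL scale U" "range g = U" "\<forall>u\<in>U. \<alpha> (g u) = u"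
    using g(1,2) inv by (simp_all add: L_GL_def subset_antisym)
  then show thesis by (rule that)
qed

end

theorem corollary3p7:
  fixes scale :: "'a::field \<Rightarrow> 'b::ab_group_add \<Rightarrow> 'b"
    and U :: "'b set"
  assumes "vector_space scale"
    and "module.subspace scale U"
    and "U \<noteq> UNIV"
  shows "is_minimal_ideal comp_right (L_GL scale U)
           {\<alpha> \<in> L_GL scale U.
              quotient_dim scale (range \<alpha>) U =o (czero :: 'b set rel)}"
proof -
  interpret vector_space scale by fact
  note U = assms(2)
  let ?S = "L_GL scale U" and ?I = "{\<alpha> \<in> L_GL scale U. range \<alpha> = U}"
  have onto: "\<alpha> ` U = U" if "\<alpha> \<in> ?S" for \<alpha>
    using that by (auto simp: L_GL_def bij_betw_def)
  \<comment> \<open>For \<open>id\<close> the extended inverse \<open>e\<close> fixes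
    \<open>U\<close> pointwise: it is a linear projection onto \<open>U\<close>.\<close>
  have "id \<in> ?S"
    using linear_id by (simp add: L_GL_def)
  then obtain e where "e \<in> ?S" "range e = U"
    by (rule L_GL_inverse_extension[OF U])
  then have "?I \<noteq> {}" by blast
  moreover have "comp_right s i \<in> ?I" if "s \<in> ?S" "i \<in> ?I" for s i
  proof -
    have si: "comp_right s i \<in> ?S"
      using that by (intro comp_right_in_L_GL) simp_all
    \<comment> \<open>Multiplying on the left can only shrink the range, but never below
      \<open>U\<close>, as the product still maps \<open>U\<close> onto itself.\<close>
    have "range (comp_right s i) \<subseteq> range i"
      by (auto simp: comp_right_def)
    moreover have "U \<subseteq> range (comp_right s i)"
      using image_mono[of U UNIV "comp_right s i"] onto[OF si] by simp
    ultimately show ?thesis using si that(2) by simp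
  qed
  moreover have "comp_right i s \<in> ?I" if "i \<in> ?I" "s \<in> ?S" for s i
  proof -
    have "range (comp_right i s) = s ` range i"
      by (simp add: comp_right_def image_comp)
    then show ?thesis
      using that onto[OF that(2)] by (simp add: comp_right_in_L_GL)
  qed
  ultimately have "semigroup_ideal comp_right ?S ?I"
    unfolding semigroup_ideal_def by (intro conjI ballI) simp_all
  moreover have "?I \<subseteq> J" if J: "semigroup_ideal comp_right ?S J" for J
  proof
    fix \<alpha> assume \<alpha>: "\<alpha> \<in> ?I"
    obtain j where j: "j \<in> J" "j \<in> ?S"
      using J unfolding semigroup_ideal_def by blast
    obtain g where g: "g \<in> ?S" "\<forall>u\<in>U. j (g u) = u"
      by (rule L_GL_inverse_extension[OF U j(2)])
    \<comment> \<open>Here \<open>range \<alpha> = U\<close> enters: \<open>j\<close> undoes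
      \<open>g\<close> on \<open>U\<close>, hence at every value of \<alpha>.\<close>
    have "j (g (\<alpha> x)) = \<alpha> x" for x
      using \<alpha> g(2) by auto
    then have "comp_right (comp_right \<alpha> g) j = \<alpha>"
      by (simp add: comp_right_def fun_eq_iff)
    moreover have "comp_right \<alpha> g \<in> ?S"
      using \<alpha> g(1) by (intro comp_right_in_L_GL) simp_all
    ultimately show "\<alpha> \<in> J"
      using J j(1) unfolding semigroup_ideal_def by (metis (lifting))
  qed
  ultimately show ?thesis
    unfolding L_GL_quotient_dim_zero[OF U] is_minimal_ideal_def by blast
qed

end
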